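(* Let $s\ge 1$ and $q$ be integers with $0\le q\le s$, let $n=T_s+q$, and let $(a,b)\in\Pi_n$ with $a>0$ and $b>0$. Set $\ell:=q-T_a-T_b\ge 0$. Then for each integer $t$ with $0\le t\le \ell$ there exists a partition $\lambda_t\in M_n^{(a,b)}$ such that the partitions $\lambda_0,\dots,\lambda_\ell$ are pairwise distinct. In particular, $$|M_n^{(a,b)}|\ge \ell+1=q-T_a-T_b+1.$$
   Context: For an integer $m\ge 0$, $T_m:=m(m+1)/2$. Compressed form: a partition $\lambda$ is written $\lambda=(L_1^{m_1},\dots,L_r^{m_r})$ with $L_1>\cdots>L_r>0$ its distinct part sizes and $m_i\ge 1$ the multiplicity of $L_i$. Gaps: $g_i=L_i-L_{i+1}$ for $1\le i<r$ and $g_r=L_r$. Set $A(\lambda):=\#\{i:g_i>1\}$ and $B(\lambda):=\#\{i:m_i>1\}$. Partition graph: for $n\ge 1$, $G_n$ is the simple graph whose vertices are the integer partitions of $n$; two distinct partitions are adjacent if one is obtained from the other by an elementary transfer of one unit from one part to another (subtract $1$ from one part and add $1$ to another part), followed by reordering. Here the receiving part may be a zero part (so a new part $1$ may be created), and parts that become $0$ are discarded. $\deg(\lambda)$ is the degree of $\lambda$ in $G_n$, $\Delta_n:=\max_{\lambda\vdash n}\deg(\lambda)$, $M_n:=\{\lambda\vdash n:\deg(\lambda)=\Delta_n\}$, $\Pi_n:=\{(A(\lambda),B(\lambda)):\lambda\in M_n\}$, and $M_n^{(a,b)}:=\{\lambda\in M_n:(A(\lambda),B(\lambda))=(a,b)\}$.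 *)

theory Defs
  imports "HOL-Library.Multiset"
begin

definition T :: "nat \<Rightarrow> nat" where
  "T m = m * (m + 1) div 2"

text \<open>A partition of \<open>n\<close> is the multiset of its (positive) parts.\<close>

definition partitions :: "nat \<Rightarrow> nat multiset set" where
  "partitions n = {l. 0 \<notin># l \<and> \<Sum>\<^sub># l = n}"

text \<open>
  The distinct part sizes of the compressed form in decreasing order, indexed from \<open>0\<close>; the
  multiplicity of the \<open>i\<close>-th one is \<open>count l (distinct_parts l ! i)\<close>.
\<close>

definition distinct_parts :: "nat multiset \<Rightarrow> nat list" where
  "distinct_parts l = rev (sorted_list_of_set (set_mset l))"

definition gap :: "nat multiset \<Rightarrow> nat \<Rightarrow> nat" where
  "gap l i =
     (if Suc i < length (distinct_parts l)
      then distinct_parts l ! i - distinct_parts l ! Suc i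
      else distinct_parts l ! i)"

definition A :: "nat multiset \<Rightarrow> nat" where
  "A l = card {i. i < length (distinct_parts l) \<and> gap l i > 1}"

definition B :: "nat multiset \<Rightarrow> nat" where
  "B l = card {i. i < length (distinct_parts l) \<and> count l (distinct_parts l ! i) > 1}"

text \<open>
  One unit is moved from a part \<open>x\<close> to another part \<open>y\<close>.  The auxiliary part \<open>0\<close> lets the
  receiver be a zero part; removing \<open>x\<close> before choosing \<open>y\<close> means that \<open>y = x\<close> is allowed only if
  that part size is repeated.
\<close>

definition transfer :: "nat multiset \<Rightarrow> nat multiset \<Rightarrow> bool" where
  "transfer l m \<longleftrightarrow>
     (\<exists>x y. x \<in># l \<and> y \<in># add_mset 0 (l - {#x#}) \<and>
        m = filter_mset (\<lambda>p. p > 0)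
              (add_mset 0 (l - {#x#}) - {#y#} + {#x - 1, y + 1#}))"

definition adjacent :: "nat multiset \<Rightarrow> nat multiset \<Rightarrow> bool" where
  "adjacent l m \<longleftrightarrow> l \<noteq> m \<and> (transfer l m \<or> transfer m l)"

definition deg :: "nat \<Rightarrow> nat multiset \<Rightarrow> nat" where
  "deg n l = card {m \<in> partitions n. adjacent l m}"

definition max_deg :: "nat \<Rightarrow> nat" where
  "max_deg n = Max (deg n ` partitions n)"

definition M :: "nat \<Rightarrow> nat multiset set" where
  "M n = {l \<in> partitions n. deg n l = max_deg n}"

definition Pi_pairs :: "nat \<Rightarrow> (nat \<times> nat) set" where
  "Pi_pairs n = (\<lambda>l. (A l, B l)) ` M n"

definition M_ab :: "nat \<Rightarrow> nat \<Rightarrow> nat \<Rightarrow> nat multiset set" where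
  "M_ab n a b = {l \<in> M n. (A l, B l) = (a, b)}"

text \<open>The maximum and the cardinalities above range over finite sets.\<close>

lemma size_le_sum_mset: "0 \<notin># l \<Longrightarrow> size l \<le> \<Sum>\<^sub># (l :: nat multiset)"
  by (induction l) auto

lemma finite_partitions: "finite (partitions n)"
proof (rule finite_subset)
  show "partitions n \<subseteq> mset ` {xs. set xs \<subseteq> {..n} \<and> length xs \<le> n}"
  proof
    fix l assume "l \<in> partitions n"
    then have l: "0 \<notin># l" "\<Sum>\<^sub># l = n" by (auto simp: partitions_def)
    obtain xs where xs: "mset xs = l" using ex_mset by blast
    have "size l \<le> n" using size_le_sum_mset l by blast
    moreover have "x \<le> n" if "x \<in># l" for x
      using sum_mset.remove[OF that] l(2) by simp
    ultimately show "l \<in> mset ` {xs. set xs \<subseteq> {..n} \<and> length xs \<le> n}"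
      using xs by auto
  qed
  show "finite (mset ` {xs. set xs \<subseteq> {..n} \<and> length xs \<le> n})"
    by (simp add: finite_lists_length_le)
qed

lemma partitions_nonempty: "partitions n \<noteq> {}"
proof -
  have "replicate_mset n 1 \<in> partitions n"
    by (simp add: partitions_def)
  then show ?thesis by blast
qed

end

theory Submission imports Defs
begin

text \<open>
  A partition with \<open>r\<close> distinct part sizes has degree \<open>r (r - 1) + A + B\<close>: there are \<open>r (r + 1)\<close>
  choices of a donor size and a receiver size, a choice is void if the sizes differ by one (one choice
  for each gap equal to \<open>1\<close>) or if the same unrepeated part is used twice, and distinct remaining
  choices give distinct neighbours. Its size is at least \<open>T r + T A + T B\<close>, and at least
  \<open>4 T r\<close> if \<open>A = B = r\<close>. Hence for \<open>n = T s + q\<close> with \<open>q \<le> s\<close> every partition of maximal degree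
  has exactly \<open>s\<close> distinct sizes, so maximality depends only on \<open>A + B\<close>, and
  \<open>T a + T b \<le> q\<close>. This forces \<open>a + b \<le> s\<close>, so the \<open>a\<close> wide gaps can be put at the top and the
  \<open>b\<close> repeated parts at the bottom without interaction; the surplus \<open>q - T a - T b\<close> can then be
  divided arbitrarily between the largest part and additional copies of \<open>1\<close>.
\<close>

section \<open>Wide gaps and repeated sizes as subsets of the set of parts\<close>

lemma card_indices_eq:
  assumes "distinct xs" and "\<And>i. i < length xs \<Longrightarrow> Q i \<longleftrightarrow> P (xs ! i)"
  shows "card {i. i < length xs \<and> Q i} = card {x \<in> set xs. P x}"
proof (rule bij_betw_same_card)
  show "bij_betw ((!) xs) {i. i < length xs \<and> Q i} {x \<in> set xs. P x}"
    using assms by (auto simp: bij_betw_def inj_on_def nth_eq_iff_index_eq in_set_conv_nth image_def)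
qed

lemma set_distinct_parts [simp]: "set (distinct_parts l) = set_mset l"
  by (simp add: distinct_parts_def)

lemma distinct_distinct_parts [simp]: "distinct (distinct_parts l)"
  by (simp add: distinct_parts_def)

lemma distinct_parts_greater:
  assumes "i < j" "j < length (distinct_parts l)"
  shows "distinct_parts l ! j < distinct_parts l ! i"
proof -
  have "sorted_wrt (>) (distinct_parts l)"
    by (simp add: distinct_parts_def sorted_wrt_rev)
  then show ?thesis using assms by (simp add: sorted_wrt_iff_nth_less)
qed

text \<open>The next entry is the largest size below the current one, so a gap is \<open>1\<close>
  exactly when the predecessor occurs. Inserting \<open>0\<close> covers the last gap, which is
  measured down to \<open>0\<close>.\<close>

lemma gap_gt_1_iff:
  assumes "0 \<notin># l" and i: "i < length (distinct_parts l)"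
  shows "gap l i > 1 \<longleftrightarrow> distinct_parts l ! i - 1 \<notin> insert 0 (set_mset l)"
proof -
  let ?xs = "distinct_parts l"
  have pos: "?xs ! k > 0" if "k < length ?xs" for k
    using nth_mem[OF that] assms(1) by (metis gr0I set_distinct_parts)
  have mem: "\<exists>j. j < length ?xs \<and> ?xs ! j = x" if "x \<in># l" for x
    using that by (metis in_set_conv_nth set_distinct_parts)
  have below: "j > i" if "j < length ?xs" "?xs ! j < ?xs ! i" for j
    using that distinct_parts_greater[of j i l] i
    by (metis linorder_neqE_nat not_less_iff_gr_or_eq)
  show ?thesis
  proof (cases "Suc i < length ?xs")
    case True
    have "?xs ! Suc i < ?xs ! i" using True by (simp add: distinct_parts_greater)
    moreover have "?xs ! Suc i \<in># l" using nth_mem[OF True] by simp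
    moreover have "x \<le> ?xs ! Suc i" if x: "x \<in># l" "x < ?xs ! i" for x
    proof -
      obtain j where j: "j < length ?xs" "?xs ! j = x" using mem[OF x(1)] by blast
      then have "i < j" using below x by blast
      then show ?thesis
        using distinct_parts_greater[of "Suc i" j l] j by (cases "j = Suc i") auto
    qed
    ultimately have "?xs ! i - 1 \<in># l \<longleftrightarrow> ?xs ! i - 1 = ?xs ! Suc i"
      using pos[OF i] by (intro iffI le_antisym) simp_all
    then show ?thesis
      using True pos[OF True] \<open>?xs ! Suc i < ?xs ! i\<close> by (auto simp: gap_def)
  next
    case False
    have "?xs ! i - 1 \<notin># l"
    proof
      assume "?xs ! i - 1 \<in># l"
      then obtain j where j: "j < length ?xs" "?xs ! j = ?xs ! i - 1" using mem by blast
      then have "i < j" using below[OF j(1)] pos[OF i] by simp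
      then show False using j(1) False by simp
    qed
    then show ?thesis using False pos[OF i] by (auto simp: gap_def)
  qed
qed

lemma A_eq_card:
  assumes "0 \<notin># l"
  shows "A l = card {x \<in> set_mset l. x - 1 \<notin> insert 0 (set_mset l)}"
  unfolding A_def
  by (subst card_indices_eq[where P = "\<lambda>x. x - 1 \<notin> insert 0 (set_mset l)"])
    (use gap_gt_1_iff[OF assms] in auto)

lemma B_eq_card: "B l = card {x \<in> set_mset l. count l x > 1}"
  unfolding B_def by (subst card_indices_eq) auto

section \<open>Transfers and neighbours\<close>

definition part :: "nat \<Rightarrow> nat multiset" where
  "part y = (if y = 0 then {#} else {#y#})"

text \<open>
  The form \<open>part y\<close> absorbs the auxiliary zero part and makes a transfer visibly symmetric under
  exchanging \<open>(x, y)\<close> with \<open>(y + 1, x - 1)\<close>.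
\<close>

lemma transfer_iff:
  assumes "0 \<notin># l"
  shows "transfer l m \<longleftrightarrow>
    (\<exists>R x y. x > 0 \<and> 0 \<notin># R \<and> l = R + {#x#} + part y \<and> m = R + {#y + 1#} + part (x - 1))"
    (is "_ \<longleftrightarrow> ?rhs")
proof
  assume "transfer l m"
  then obtain x y where x: "x \<in># l" and y: "y \<in># add_mset 0 (l - {#x#})"
    and m: "m = filter_mset (\<lambda>p. p > 0) (add_mset 0 (l - {#x#}) - {#y#} + {#x - 1, y + 1#})"
    by (auto simp: transfer_def)
  have "x > 0" using x assms by (cases x) auto
  have keep: "filter_mset (\<lambda>p. p > 0) l = l"
    using assms by (auto simp: filter_mset_eq_conv intro!: gr0I)
  define R where "R = l - {#x#} - part y"
  have "part y \<subseteq># l - {#x#}" using y by (auto simp: part_def)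
  then have "l = R + {#x#} + part y"
    using subset_mset.diff_add[of "part y" "l - {#x#}"] x by (simp add: R_def)
  moreover have R: "0 \<notin># R" using assms unfolding R_def by (meson in_diffD)
  moreover have "m = R + {#y + 1#} + part (x - 1)"
  proof (cases "y = 0")
    case True
    show ?thesis using True keep \<open>x > 0\<close> by (auto simp: m part_def R_def)
  next
    case False
    have "add_mset 0 (l - {#x#}) - {#y#} = add_mset 0 (l - {#x#} - {#y#})"
      using False by (simp add: diff_add_mset_swap)
    then show ?thesis using False keep \<open>x > 0\<close> by (auto simp: m part_def R_def)
  qed
  ultimately show ?rhs using \<open>x > 0\<close> by blast
next
  assume ?rhs
  then obtain R x y where R: "x > 0" "0 \<notin># R" "l = R + {#x#} + part y"
    "m = R + {#y + 1#} + part (x - 1)" by blast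
  have "filter_mset (\<lambda>p. p > 0) R = R"
    using R(2) by (auto simp: filter_mset_eq_conv intro!: gr0I)
  then have "x \<in># l \<and> y \<in># add_mset 0 (l - {#x#}) \<and>
        m = filter_mset (\<lambda>p. p > 0)
              (add_mset 0 (l - {#x#}) - {#y#} + {#x - 1, y + 1#})"
    using R by (auto simp: part_def)
  then show "transfer l m" unfolding transfer_def by blast
qed

lemma transfer_sym:
  assumes "0 \<notin># l" "transfer l m"
  shows "transfer m l"
proof -
  obtain R x y where R: "x > 0" "0 \<notin># R" "l = R + {#x#} + part y"
    "m = R + {#y + 1#} + part (x - 1)" using assms(2) unfolding transfer_iff[OF assms(1)] by blast
  have m: "0 \<notin># m" using R by (auto simp: part_def)
  show ?thesis
    unfolding transfer_iff[OF m] using R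
    by (intro exI[of _ R] exI[of _ "y + 1"] exI[of _ "x - 1"]) simp
qed

text \<open>For \<open>j > 0\<close> this is the \<open>j\<close>-th part of the conjugate
  partition; a transfer moves one box from column \<open>x\<close> to column
  \<open>y + 1\<close>.\<close>

definition num_ge :: "nat \<Rightarrow> nat multiset \<Rightarrow> nat" where
  "num_ge j l = size (filter_mset (\<lambda>p. p \<ge> j) l)"

lemma num_ge_transfer:
  assumes "x > 0" "j > 0" "l = R + {#x#} + part y" "m = R + {#y + 1#} + part (x - 1)"
  shows "num_ge j m + of_bool (x = j) = num_ge j l + of_bool (y + 1 = j)"
  using assms by (auto simp: num_ge_def part_def)

text \<open>Here \<open>y = 0\<close> stands for the zero receiver, and the pairs with
  \<open>x = y + 1\<close> are left out because their transfer gives \<open>l\<close> back.\<close>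

definition transfer_pairs :: "nat multiset \<Rightarrow> (nat \<times> nat) set" where
  "transfer_pairs l = {(x, y). {#x#} + part y \<subseteq># l \<and> x \<noteq> y + 1}"

definition apply_transfer :: "nat multiset \<Rightarrow> nat \<times> nat \<Rightarrow> nat multiset" where
  "apply_transfer l = (\<lambda>(x, y). l - ({#x#} + part y) + {#y + 1#} + part (x - 1))"

lemma num_ge_apply_transfer:
  assumes "0 \<notin># l" "(x, y) \<in> transfer_pairs l" "j > 0"
  shows "num_ge j (apply_transfer l (x, y)) + of_bool (x = j) = num_ge j l + of_bool (y + 1 = j)"
proof (rule num_ge_transfer)
  have sub: "{#x#} + part y \<subseteq># l" using assms by (simp add: transfer_pairs_def)
  then have "x \<in># l" by (auto simp: insert_subset_eq_iff)
  then show "x > 0" using assms by (cases x) auto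
  show "l = l - ({#x#} + part y) + {#x#} + part y"
    using subset_mset.diff_add[OF sub] by (simp add: ac_simps)
qed (use assms in \<open>auto simp: apply_transfer_def\<close>)

text \<open>
  The number of parts of size at least \<open>j\<close> drops only at \<open>j = x\<close> and grows only at \<open>j = y + 1\<close>, so
  the resulting partition determines the transfer.
\<close>

lemma inj_on_apply_transfer:
  assumes "0 \<notin># l"
  shows "inj_on (apply_transfer l) (transfer_pairs l)"
proof (rule inj_onI, clarify)
  fix x y x' y'
  assume p: "(x, y) \<in> transfer_pairs l" "(x', y') \<in> transfer_pairs l"
    and eq: "apply_transfer l (x, y) = apply_transfer l (x', y')"
  have pos: "x > 0" "x' > 0"
    using p assms by (auto simp: transfer_pairs_def insert_subset_eq_iff intro!: gr0I)
  have ne: "x \<noteq> y + 1" "x' \<noteq> y' + 1" using p by (auto simp: transfer_pairs_def)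
  have "of_bool (x = j) + of_bool (y' + 1 = j) = (of_bool (x' = j) + of_bool (y + 1 = j) :: nat)"
    if "j > 0" for j
    using num_ge_apply_transfer[OF assms p(1) that] num_ge_apply_transfer[OF assms p(2) that]
    unfolding eq by linarith
  \<comment> \<open>Since \<open>x\<close> differs from \<open>y + 1\<close>, the instance
    \<open>j = x\<close> forces \<open>x' = x\<close>, and \<open>j = y + 1\<close> forces
    \<open>y' = y\<close>.\<close>
  from this[of x] this[of "y + 1"] pos ne show "x = x' \<and> y = y'"
    by (auto split: if_splits simp: of_bool_def)
qed

lemma neighbours_eq:
  assumes "l \<in> partitions n"
  shows "{m \<in> partitions n. adjacent l m} = apply_transfer l ` transfer_pairs l"
proof -
  have l: "0 \<notin># l" "\<Sum>\<^sub># l = n" using assms by (auto simp: partitions_def)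
  have adj: "adjacent l m \<longleftrightarrow> l \<noteq> m \<and> transfer l m" if "m \<in> partitions n" for m
    using that transfer_sym[of m l] by (auto simp: adjacent_def partitions_def)
  show ?thesis
  proof (intro equalityI subsetI)
    fix m assume m: "m \<in> {m \<in> partitions n. adjacent l m}"
    then have "l \<noteq> m" "transfer l m" using adj by auto
    then obtain R x y where R: "x > 0" "l = R + {#x#} + part y"
      "m = R + {#y + 1#} + part (x - 1)" unfolding transfer_iff[OF l(1)] by blast
    have "x \<noteq> y + 1" using R \<open>l \<noteq> m\<close> by auto
    then have "(x, y) \<in> transfer_pairs l" using R by (simp add: transfer_pairs_def)
    moreover have "m = apply_transfer l (x, y)" using R by (simp add: apply_transfer_def)
    ultimately show "m \<in> apply_transfer l ` transfer_pairs l" by blast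
  next
    fix m assume "m \<in> apply_transfer l ` transfer_pairs l"
    then obtain x y where p: "(x, y) \<in> transfer_pairs l" and m: "m = apply_transfer l (x, y)"
      by auto
    have sub: "{#x#} + part y \<subseteq># l" and ne: "x \<noteq> y + 1"
      using p by (auto simp: transfer_pairs_def)
    have x: "x > 0" using sub l by (auto simp: insert_subset_eq_iff intro!: gr0I)
    define R where "R = l - ({#x#} + part y)"
    have lR: "l = R + {#x#} + part y"
      using subset_mset.diff_add[OF sub] by (simp add: R_def ac_simps)
    have mR: "m = R + {#y + 1#} + part (x - 1)" by (simp add: m apply_transfer_def R_def)
    have R0: "0 \<notin># R" using lR l by auto
    have "transfer l m" unfolding transfer_iff[OF l(1)] using x R0 lR mR by blast
    moreover have "m \<in> partitions n"
      using x R0 lR mR l by (auto simp: partitions_def part_def)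
    \<comment> \<open>The number of parts of size at least \<open>x\<close> drops by one.\<close>
    moreover have "l \<noteq> m"
      using num_ge_apply_transfer[OF l(1) p x] m ne by auto
    ultimately show "m \<in> {m \<in> partitions n. adjacent l m}" using adj by auto
  qed
qed

section \<open>The degree formula\<close>

lemma card_transfer_pairs:
  assumes "0 \<notin># l"
  shows "card (transfer_pairs l) + card (set_mset l) = (card (set_mset l))\<^sup>2 + A l + B l"
proof -
  let ?S = "set_mset l"
  let ?Y = "\<lambda>x. insert 0 ?S - {x - 1} - (if count l x > 1 then {} else {x})"
  have "transfer_pairs l = Sigma ?S ?Y"
    using assms
    by (auto simp: transfer_pairs_def part_def insert_subset_eq_iff in_diff_count
        not_less less_Suc_eq count_greater_zero_iff[symmetric] split: if_splits
        simp del: count_greater_zero_iff)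
  then have "card (transfer_pairs l) = (\<Sum>x\<in>?S. card (?Y x))"
    by simp
  \<comment> \<open>Of the \<open>card ?S + 1\<close> receivers, \<open>x - 1\<close> is lost if
    available and \<open>x\<close> is lost if unrepeated; these are different because
    \<open>x > 0\<close>.\<close>
  moreover have "card (?Y x) + 1 = card ?S + of_bool (x - 1 \<notin> insert 0 ?S) + of_bool (count l x > 1)"
    if "x \<in> ?S" for x
  proof -
    have "x \<noteq> 0" using that assms by metis
    have c: "card (insert 0 ?S) = card ?S + 1" using assms by simp
    have "card (insert 0 ?S - {x - 1}) + of_bool (x - 1 \<in> insert 0 ?S) = card ?S + 1"
      using c by (cases "x - 1 \<in> insert 0 ?S") (auto simp: card_Diff_singleton)
    moreover have "card (insert 0 ?S - {x - 1} - {x}) + 1 = card (insert 0 ?S - {x - 1})"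
      using that \<open>x \<noteq> 0\<close> by (intro card_Suc_Diff1[unfolded Suc_eq_plus1]) auto
    ultimately show ?thesis by (cases "x - 1 \<in> insert 0 ?S") auto
  qed
  then have "(\<Sum>x\<in>?S. card (?Y x) + 1) =
      (\<Sum>x\<in>?S. card ?S + of_bool (x - 1 \<notin> insert 0 ?S) + of_bool (count l x > 1))"
    by (intro sum.cong) auto
  ultimately show ?thesis
    unfolding A_eq_card[OF assms] B_eq_card
    by (simp add: sum.distrib sum_Suc power2_eq_square Int_def)
qed

lemma deg_eq:
  assumes "l \<in> partitions n"
  shows "deg n l + card (set_mset l) = (card (set_mset l))\<^sup>2 + A l + B l"
  unfolding deg_def neighbours_eq[OF assms]
  using assms inj_on_apply_transfer card_transfer_pairs
  by (simp add: card_image partitions_def)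

section \<open>Lower bounds for the size of a partition\<close>

lemma T_Suc: "T (Suc m) = T m + Suc m"
  by (simp add: T_def)

lemma T_ge: "m \<le> T m"
  by (induction m) (auto simp: T_Suc T_def)

lemma two_T: "2 * T m = m * (m + 1)"
  by (simp add: T_def)

lemma T_mono: "i \<le> j \<Longrightarrow> T i \<le> T j"
  unfolding T_def by (intro div_le_mono mult_le_mono) auto

text \<open>Each element starting a new block of consecutive integers forces a missing value below it.\<close>

lemma sum_ge_T_blocks:
  fixes S :: "nat set"
  assumes "finite S" "0 \<notin> S"
  shows "T (card S) + T (card {x \<in> S. x - 1 \<notin> insert 0 S}) \<le> \<Sum>S"
  using assms
proof (induction rule: finite_linorder_max_induct)
  case empty
  then show ?case by (simp add: T_def)
next
  case (insert b S)
  let ?G = "\<lambda>S. {x \<in> S. x - 1 \<notin> insert 0 S}"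
  have "b > 0" using insert by (cases b) auto
  have bS: "b \<notin> S" using insert by auto
  \<comment> \<open>The new element \<open>b\<close> exceeds all others, so it fills no missing
    predecessor.\<close>
  have G: "?G (insert b S) = ?G S \<union> (if b - 1 \<notin> insert 0 S then {b} else {})"
  proof -
    have "x - 1 \<noteq> b" if "x \<in> insert b S" for x
      using that insert.hyps(2) \<open>b > 0\<close> by fastforce
    then show ?thesis by auto
  qed
  have cG: "card (?G (insert b S)) = card (?G S) + of_bool (b - 1 \<notin> insert 0 S)"
    using bS insert.hyps(1) unfolding G by simp
  \<comment> \<open>The elements and the missing predecessors form disjoint subsets of
    \<open>{1..b}\<close>.\<close>
  have "card (insert b S) + card (?G (insert b S)) \<le> b"
  proof -
    have "(\<lambda>x. x - 1) ` ?G (insert b S) \<inter> insert b S = {}" by auto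
    moreover have "inj_on (\<lambda>x. x - 1) (?G (insert b S))"
    proof (rule inj_onI)
      fix x y assume "x \<in> ?G (insert b S)" "y \<in> ?G (insert b S)" "x - 1 = y - 1"
      moreover have "x \<noteq> 0" "y \<noteq> 0" using calculation insert.prems by auto
      ultimately show "x = y" by linarith
    qed
    moreover have "(\<lambda>x. x - 1) ` ?G (insert b S) \<union> insert b S \<subseteq> {1..b}"
    proof -
      have "1 \<le> x \<and> x \<le> b" if "x \<in> insert b S" for x
        using that insert.prems insert.hyps(2) \<open>b > 0\<close> by (cases "x = 0") force+
      then show ?thesis by fastforce
    qed
    then have "card ((\<lambda>x. x - 1) ` ?G (insert b S) \<union> insert b S) \<le> b"
      using card_mono[of "{1..b}"] by fastforce
    moreover have "finite ((\<lambda>x. x - 1) ` ?G (insert b S))" "finite (insert b S)"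
      using insert.hyps(1) by auto
    ultimately show ?thesis
      using card_Un_disjoint[of "(\<lambda>x. x - 1) ` ?G (insert b S)" "insert b S"]
        card_image[of "\<lambda>x. x - 1" "?G (insert b S)"] by linarith
  qed
  moreover have "T (card (?G S)) + card (?G (insert b S)) \<ge> T (card (?G (insert b S)))"
    unfolding cG by (cases "b - 1 \<notin> insert 0 S") (simp_all add: T_Suc)
  moreover have "T (card S) + T (card (?G S)) \<le> \<Sum>S" using insert by auto
  moreover have "\<Sum>(insert b S) = b + \<Sum>S" "card (insert b S) = Suc (card S)"
    using bS insert.hyps(1) by auto
  ultimately show ?case by (simp add: T_Suc)
qed

lemma sum_ge_T: "finite S \<Longrightarrow> 0 \<notin> S \<Longrightarrow> T (card S) \<le> \<Sum>S"
  using sum_ge_T_blocks by (metis add_leD1)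

text \<open>One copy of each size and a second copy of each repeated size together form a
  submultiset of \<open>l\<close>.\<close>

lemma sum_mset_ge:
  fixes l :: "nat multiset"
  shows "\<Sum>(set_mset l) + \<Sum>{x \<in> set_mset l. count l x > 1} \<le> \<Sum>\<^sub># l"
proof -
  have "mset_set (set_mset l) + mset_set {x \<in> set_mset l. count l x > 1} \<subseteq># l"
    by (rule mset_subset_eqI) (auto simp: count_mset_set' Suc_le_eq)
  then have "\<Sum>\<^sub># (mset_set (set_mset l) + mset_set {x \<in> set_mset l. count l x > 1}) \<le> \<Sum>\<^sub># l"
    by (metis sum_mset.union subset_mset.le_iff_add le_add1)
  then show ?thesis by (simp add: sum_unfold_sum_mset)
qed

lemma partition_ge_T:
  assumes "l \<in> partitions n"
  shows "T (card (set_mset l)) + T (A l) + T (B l) \<le> n"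
proof -
  have l: "0 \<notin># l" "\<Sum>\<^sub># l = n" using assms by (auto simp: partitions_def)
  have "T (card (set_mset l)) + T (A l) \<le> \<Sum>(set_mset l)"
    using sum_ge_T_blocks[of "set_mset l"] A_eq_card l by simp
  moreover have "T (B l) \<le> \<Sum>{x \<in> set_mset l. count l x > 1}"
    using sum_ge_T l by (simp add: B_eq_card)
  ultimately show ?thesis using sum_mset_ge[of l] l by linarith
qed

lemma A_le: "0 \<notin># l \<Longrightarrow> A l \<le> card (set_mset l)"
  by (simp add: A_eq_card card_mono)

lemma B_le: "B l \<le> card (set_mset l)"
  by (simp add: B_eq_card card_mono)

text \<open>If every gap is wide, the distinct sizes sum to at least twice \<open>T\<close>; if
  every size is repeated, their second copies contribute as much again.\<close>

lemma partition_ge_4T: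
  assumes "l \<in> partitions n" "A l = card (set_mset l)" "B l = card (set_mset l)"
  shows "4 * T (card (set_mset l)) \<le> n"
proof -
  have l: "0 \<notin># l" "\<Sum>\<^sub># l = n" using assms by (auto simp: partitions_def)
  have "2 * T (card (set_mset l)) \<le> \<Sum>(set_mset l)"
    using sum_ge_T_blocks[of "set_mset l"] A_eq_card assms l by simp
  moreover have "{x \<in> set_mset l. count l x > 1} = set_mset l"
    using assms by (intro card_subset_eq) (auto simp: B_eq_card)
  ultimately show ?thesis using sum_mset_ge[of l] l by simp
qed

section \<open>The number of distinct sizes at maximal degree\<close>

lemma deg_le_max_deg: "l \<in> partitions n \<Longrightarrow> deg n l \<le> max_deg n"
  by (simp add: max_deg_def finite_partitions)

lemma sum_atLeastAtMost_1: "\<Sum>{1..m} = T m"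
  by (induction m) (auto simp: T_Suc T_def)

text \<open>The witness is a staircase with all of \<open>q\<close> added to its largest part: for
  \<open>q > 0\<close> this widens the top gap and gains one neighbour.\<close>

lemma max_deg_ge:
  assumes "s \<ge> 1"
  shows "s\<^sup>2 + of_bool (q > 0) \<le> max_deg (T s + q) + s"
proof -
  define S where "S = insert (s + q) {1..<s}"
  have cS: "card S = s" "finite S" "0 \<notin> S" using assms by (auto simp: S_def)
  obtain k where k: "s = Suc k" using assms by (cases s) auto
  have "\<Sum>S = T s + q"
    using sum_atLeastAtMost_1[of k] by (simp add: S_def k T_Suc atLeastLessThanSuc_atLeastAtMost)
  then have p: "mset_set S \<in> partitions (T s + q)"
    using cS by (simp add: partitions_def sum_unfold_sum_mset)
  have "A (mset_set S) \<ge> of_bool (q > 0)"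
  proof (cases "q > 0")
    case True
    then have "s + q \<in> {x \<in> S. x - 1 \<notin> insert 0 S}"
      using assms by (auto simp: S_def)
    then have "card {x \<in> S. x - 1 \<notin> insert 0 S} > 0"
      using cS by (subst card_gt_0_iff) auto
    then show ?thesis using cS by (simp add: A_eq_card)
  qed simp
  then show ?thesis using deg_eq[OF p] deg_le_max_deg[OF p] cS by simp
qed

lemma card_parts_of_M:
  assumes "s \<ge> 1" "q \<le> s" "l \<in> M (T s + q)"
  shows "card (set_mset l) = s"
proof -
  let ?r = "card (set_mset l)"
  have p: "l \<in> partitions (T s + q)" and d: "deg (T s + q) l = max_deg (T s + q)"
    using assms by (auto simp: M_def)
  have p0: "0 \<notin># l" "\<Sum>\<^sub># l = T s + q" using p by (auto simp: partitions_def)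
  have AB: "A l \<le> ?r" "B l \<le> ?r" using A_le B_le p0 by auto
  have "\<not> ?r > s"
  proof
    assume "?r > s"
    then have "T (Suc s) \<le> T ?r" by (intro T_mono) simp
    then show False using partition_ge_T[OF p] assms by (simp add: T_Suc)
  qed
  moreover have "\<not> ?r < s"
  proof
    assume less: "?r < s"
    obtain k where k: "s = Suc k" using assms by (cases s) auto
    have main: "s\<^sup>2 + of_bool (q > 0) + ?r \<le> ?r\<^sup>2 + A l + B l + s"
      using deg_eq[OF p] max_deg_ge[OF assms(1), of q] d by linarith
    \<comment> \<open>As \<open>A l\<close> and \<open>B l\<close> are at most \<open>?r\<close>,
      \<open>main\<close> bounds \<open>k * (k + 1) + of_bool (q > 0)\<close> by
      \<open>?r * (?r + 1)\<close>. So \<open>?r\<close> cannot be below \<open>k\<close>, and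
      \<open>?r = k\<close> makes every estimate an equality.\<close>
    have "?r = k"
    proof (rule ccontr)
      assume "?r \<noteq> k"
      then have "?r + 1 \<le> k" using less k by simp
      then have "?r * (?r + 1) < k * (k + 1)"
        by (intro mult_less_le_imp_less) auto
      then show False using main AB k by (simp add: power2_eq_square)
    qed
    then have "A l = ?r \<and> B l = ?r \<and> q = 0"
      using main AB k by (cases "q > 0") (auto simp: power2_eq_square)
    then have "4 * T k \<le> T (Suc k)" using partition_ge_4T[OF p] k \<open>?r = k\<close> by simp
    then have "3 * (2 * T k) \<le> 2 * Suc k" by (simp add: T_Suc)
    then have "k = 0" unfolding two_T by (cases k) auto
    \<comment> \<open>With \<open>k = 0\<close> the partition is empty, although its sum is
      \<open>T 1 = 1\<close>.\<close>
    then show False using \<open>?r = k\<close> p0 assms k by (auto simp: T_def)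
  qed
  ultimately show ?thesis by simp
qed

section \<open>The extremal shapes\<close>

text \<open>
  The extremal shape has the \<open>a\<close> widened gaps at the \<open>a\<close> largest parts and the \<open>b\<close> repeated parts
  at the bottom; the surplus \<open>c + d\<close> is split between the largest part and copies of \<open>1\<close>.
\<close>

definition shape_parts :: "nat \<Rightarrow> nat \<Rightarrow> nat \<Rightarrow> nat set" where
  "shape_parts u a c = {1..u} \<union> (\<lambda>i. u + 2 * i) ` {1..<a} \<union> {u + 2 * a + c}"

definition shape :: "nat \<Rightarrow> nat \<Rightarrow> nat \<Rightarrow> nat \<Rightarrow> nat \<Rightarrow> nat multiset" where
  "shape u a b c d = mset_set (shape_parts u a c) + mset_set {1..b} + replicate_mset d 1"

lemma finite_shape_parts [simp]: "finite (shape_parts u a c)"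
  by (simp add: shape_parts_def)

lemma shape_parts_pos [simp]: "a > 0 \<Longrightarrow> 0 \<notin> shape_parts u a c"
  by (auto simp: shape_parts_def)

text \<open>Compared with the staircase \<open>1, ..., u + a\<close>, the part \<open>u + i\<close>
  is raised by \<open>i\<close> for each \<open>i\<close> from \<open>1\<close> to \<open>a\<close>,
  which adds \<open>T a\<close>; the top part also receives \<open>c\<close>. Exactly these
  \<open>a\<close> raised parts lack their predecessor.\<close>

lemma sum_card_shape_parts:
  assumes "a > 0"
  shows "card (shape_parts u a c) = u + a"
    and "\<Sum>(shape_parts u a c) = T (u + a) + T a + c"
    and "card {x \<in> shape_parts u a c. x - 1 \<notin> insert 0 (shape_parts u a c)} = a"
proof -
  let ?H = "(\<lambda>i. u + 2 * i) ` {1..<a}" and ?S = "shape_parts u a c"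
  let ?G = "insert (u + 2 * a + c) ?H"
  have inj: "inj_on (\<lambda>i. u + 2 * i) {1..<a}" by (auto simp: inj_on_def)
  have nH: "u + 2 * a + c \<notin> ?H" by auto
  have cH: "card ?H = a - 1" using inj by (simp add: card_image)
  have cG: "card ?G = a" using nH cH assms by simp
  have S: "?S = {1..u} \<union> ?G" and disj: "{1..u} \<inter> ?G = {}"
    using assms by (auto simp: shape_parts_def)
  show "card ?S = u + a" unfolding S using disj cG by (subst card_Un_disjoint) auto
  have "{x \<in> ?S. x - 1 \<notin> insert 0 ?S} = ?G"
  proof (intro equalityI subsetI)
    fix x assume "x \<in> {x \<in> ?S. x - 1 \<notin> insert 0 ?S}"
    then show "x \<in> ?G" unfolding S by auto
  next
    fix x assume x: "x \<in> ?G"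
    have "x - 1 \<notin> ?H" if "x \<in> ?H"
      using that by auto presburger
    then show "x \<in> {x \<in> ?S. x - 1 \<notin> insert 0 ?S}"
      using x assms unfolding S by auto
  qed
  then show "card {x \<in> ?S. x - 1 \<notin> insert 0 ?S} = a" using cG by simp
  have sumH: "(\<Sum>i\<in>{1..<k}. u + 2 * i) + u + 2 * k + T u = T (u + k) + T k" if "k > 0" for k
    using that
  proof (induction k rule: nat_induct_non_zero)
    case 1
    then show ?case by (simp add: T_def)
  next
    case (Suc k)
    then show ?case by (simp add: T_Suc)
  qed
  have "\<Sum>?S = T u + \<Sum>?G"
    unfolding S using disj sum_atLeastAtMost_1 by (subst sum.union_disjoint) auto
  also have "\<Sum>?G = u + 2 * a + c + (\<Sum>i\<in>{1..<a}. u + 2 * i)"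
    using nH inj by (simp add: sum.reindex)
  finally show "\<Sum>?S = T (u + a) + T a + c" using sumH[OF assms] by simp
qed

lemma set_shape:
  assumes "0 < b" "b \<le> u"
  shows "set_mset (shape u a b c d) = shape_parts u a c"
  using assms by (auto simp: shape_def shape_parts_def)

lemma A_shape:
  assumes "a > 0" "0 < b" "b \<le> u"
  shows "A (shape u a b c d) = a"
  using assms by (simp add: A_eq_card set_shape sum_card_shape_parts(3)[simplified])

text \<open>Because \<open>b > 0\<close>, the size \<open>1\<close> is already repeated, so the
  \<open>d\<close> further copies of it create no new repeated size.\<close>

lemma B_shape:
  assumes "0 < b" "b \<le> u"
  shows "B (shape u a b c d) = b"
proof -
  have "{x \<in> shape_parts u a c. count (shape u a b c d) x > 1} = {1..b}"
    using assms by (auto simp: shape_def count_mset_set' shape_parts_def split: if_splits)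
  then show ?thesis using assms by (simp add: B_eq_card set_shape)
qed

lemma shape_in_partitions:
  assumes "a > 0"
  shows "shape u a b c d \<in> partitions (T (u + a) + T a + T b + c + d)"
  using assms sum_card_shape_parts(2)[OF assms, of u c] sum_atLeastAtMost_1[of b]
  by (auto simp: partitions_def shape_def sum_unfold_sum_mset)

text \<open>Extra copies do not affect the set of sizes, whose sum determines
  \<open>c\<close>.\<close>

lemma shape_eq_imp_eq:
  assumes "shape u a b c d = shape u a b c' d'" "0 < b" "b \<le> u" "a > 0"
  shows "c = c'"
proof -
  have "shape_parts u a c = shape_parts u a c'"
    using assms set_shape by metis
  then show ?thesis using sum_card_shape_parts(2)[OF assms(4)] by (metis add_left_cancel)
qed

theorem proposition6p4:
  fixes n s q a b :: nat
  assumes "s \<ge> 1" and "q \<le> s" and "n = T s + q"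
    and "(a, b) \<in> Pi_pairs n" and "a > 0" and "b > 0"
  shows "T a + T b \<le> q \<and>
    (\<exists>lam :: nat \<Rightarrow> nat multiset.
       (\<forall>t \<le> q - T a - T b. lam t \<in> M_ab n a b) \<and> inj_on lam {0..q - T a - T b}) \<and>
    card (M_ab n a b) \<ge> q - T a - T b + 1"
proof -
  obtain l where l: "l \<in> M n" "A l = a" "B l = b"
    using assms(4) by (auto simp: Pi_pairs_def)
  have lp: "l \<in> partitions n" "deg n l = max_deg n" using l by (auto simp: M_def)
  have r: "card (set_mset l) = s" using card_parts_of_M assms l by metis
  have Tab: "T a + T b \<le> q" using partition_ge_T[OF lp(1)] r l assms by simp
  \<comment> \<open>Since \<open>T m\<close> is at least \<open>m\<close>, \<open>a + b\<close> is
    at most \<open>q\<close>, hence at most \<open>s\<close>; this leaves room for \<open>b\<close>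
    repeated sizes among \<open>1, ..., u\<close>.\<close>
  have ab: "a + b \<le> s" using Tab T_ge[of a] T_ge[of b] assms by linarith
  define u where "u = s - a"
  have u: "u + a = s" "b \<le> u" using ab by (auto simp: u_def)
  define e where "e = q - T a - T b"
  define lam where "lam t = shape u a b t (e - t)" for t
  have mem: "lam t \<in> M_ab n a b" if "t \<le> e" for t
  proof -
    have "T (u + a) + T a + T b + t + (e - t) = n"
      using that Tab u assms by (simp add: e_def)
    then have p: "lam t \<in> partitions n"
      using shape_in_partitions assms unfolding lam_def by metis
    have AB: "A (lam t) = a" "B (lam t) = b" and c: "card (set_mset (lam t)) = s"
      using A_shape B_shape set_shape sum_card_shape_parts(1) assms u by (auto simp: lam_def)
    \<comment> \<open>The degree depends only on the number of sizes, \<open>A\<close> and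
      \<open>B\<close>, so maximality passes from \<open>l\<close> to \<open>lam t\<close>.\<close>
    have "deg n (lam t) = deg n l"
      using deg_eq[OF p] deg_eq[OF lp(1)] AB c r l by simp
    then show ?thesis using p lp AB by (simp add: M_ab_def M_def)
  qed
  have inj: "inj_on lam {0..e}"
    using shape_eq_imp_eq assms u by (auto simp: inj_on_def lam_def)
  have "finite (M_ab n a b)"
    using finite_partitions by (rule finite_subset[rotated]) (auto simp: M_ab_def M_def)
  then have "card {0..e} \<le> card (M_ab n a b)"
    using inj mem by (intro card_inj_on_le[of lam]) auto
  then show ?thesis using Tab mem inj unfolding e_def by auto
qed

end
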